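(* Let $s > k \ge \ell \ge 0$ and $m \ge 0$ be integers. Suppose $A_1,\dots,A_m,B_1,\dots,B_m$ are finite sets such that $|A_i| + |B_i| = s$ and $|A_i \cap B_i| \le \ell$ for all $i \in [m]$, and $|A_i \cap B_j| + |A_j \cap B_i| \ge 2(k+1)$ for all $1 \le i < j \le m$. Then $$m \le f'\big(s-2(k+1),\, 2(k+1)-2\ell;\, \{0,1\}\big) \le \frac{2^{s-2\ell-1}}{\sum_{i=0}^{k-\ell} \binom{s-2\ell-1}{i}}.$$
   Context: For $p,q \in \{0,1\}^n$, $\mathrm{dist}(p,q)$ is the Hamming distance (number of coordinates in which they differ). For an integer $t$ and an integer $r \ge 1$, $f'(t,r;\{0,1\})$ is the maximum $m$ such that there exist an integer $n > t$ and $a_1,\dots,a_m,b_1,\dots,b_m \in \{0,1\}^n$ with $\mathrm{dist}(a_i,b_i) \ge t+r$ for all $i \in [m]$ and $\mathrm{dist}(a_i,b_j)+\mathrm{dist}(a_j,b_i) \le 2t$ for all distinct $i,j \in [m]$.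
   Formalization: The second inequality is asserted only when s ≥ 2ℓ+1; for s ≤ 2ℓ the exponent s−2ℓ−1 is negative and the bound fails or is undefined (e.g. s=2, k=ℓ=1 gives f'=1 but bound 1/2). The first inequality is stated for all parameters. *)

theory Defs
  imports Complex_Main "HOL-Library.FuncSet"
begin

definition cube :: "nat \<Rightarrow> (nat \<Rightarrow> nat) set" where
  "cube n = ({1..n} \<rightarrow>\<^sub>E {0, 1})"

definition hamming_dist :: "nat \<Rightarrow> (nat \<Rightarrow> nat) \<Rightarrow> (nat \<Rightarrow> nat) \<Rightarrow> nat" where
  "hamming_dist n p q = card {c \<in> {1..n}. p c \<noteq> q c}"

definition admissible :: "int \<Rightarrow> int \<Rightarrow> nat \<Rightarrow> bool" where
  "admissible t r m \<longleftrightarrow>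
     (\<exists>(n::nat) (a :: nat \<Rightarrow> nat \<Rightarrow> nat) (b :: nat \<Rightarrow> nat \<Rightarrow> nat).
        int n > t \<and>
        (\<forall>i\<in>{1..m}. a i \<in> cube n \<and> b i \<in> cube n) \<and>
        (\<forall>i\<in>{1..m}. int (hamming_dist n (a i) (b i)) \<ge> t + r) \<and>
        (\<forall>i\<in>{1..m}. \<forall>j\<in>{1..m}. i \<noteq> j \<longrightarrow>
           int (hamming_dist n (a i) (b j)) + int (hamming_dist n (a j) (b i)) \<le> 2 * t))"

text \<open>
  The quantity $f'(t,r;\{0,1\})$ for $r \ge 1$. The parameter \<open>t\<close> may be negative. The value is
  unspecified if there is no largest admissible \<open>m\<close>.
\<close>

definition f_prime :: "int \<Rightarrow> int \<Rightarrow> nat" where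
  "f_prime t r = (GREATEST m. admissible t r m)"

text \<open>
  In a bound of the form $2^N / \sum_{i=0}^{k-l} {N \choose i}$ with $N = s - 2l - 1$, the case
  $N < 0$ has to be excluded: it is compatible with $s > k \ge l \ge 0$, but there
  $f'(s-2(k+1), 2(k+1)-2l; \{0,1\}) = 1$, while for instance $s = 2$, $k = l = 1$ would give the
  value $1/2$ (with ${-1 \choose 0} = 1$). The comparison of \<open>m\<close> with \<open>f_prime\<close> needs no such
  restriction.
\<close>

end

theory Submission imports Defs begin

text \<open>
  Replacing sets by indicator vectors, \<open>|A| + |B| - 2 |A \<inter> B|\<close> is a Hamming distance, which gives the
  first inequality. The second is a sphere-packing argument. Let \<open>S\<^sub>i\<close> be the set of coordinates
  where \<open>a\<^sub>i\<close> and \<open>b\<^sub>i\<close> differ, \<open>d\<^sub>i = |S\<^sub>i| \<ge> t + r\<close> and \<open>r = 2p + 2\<close>. The hypothesis forces \<open>a\<^sub>i\<close> and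
  \<open>a\<^sub>j\<close> to disagree in at least \<open>(d\<^sub>i + d\<^sub>j)/2 - t\<close> places of \<open>S\<^sub>i \<inter> S\<^sub>j\<close>. Puncture each \<open>S\<^sub>i\<close> by deleting
  its one or two largest coordinates (so that the size has the parity of \<open>t + 1\<close>); since always the
  largest ones go, a pair loses no more common coordinates than one of its members does. The sets of
  all \<open>x\<close> that differ from \<open>a\<^sub>i\<close> in at most \<open>p + \<lfloor>(d\<^sub>i - t - r)/2\<rfloor>\<close> places of the punctured \<open>S\<^sub>i\<close> are
  then disjoint, and each fills at least the fraction
  \<open>2\<^sup>-\<^sup>N (\<Sum>i\<le>p. N choose i)\<close> of the cube, where \<open>N = t + r - 1\<close>.
\<close>

section \<open>Volumes of Hamming balls\<close>

lemma card_subsets_card_le: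
  assumes "finite T"
  shows "card {Z. Z \<subseteq> T \<and> card Z \<le> p} = (\<Sum>i\<le>p. card T choose i)"
proof -
  have "{Z. Z \<subseteq> T \<and> card Z \<le> p} = (\<Union>i\<le>p. {Z. Z \<subseteq> T \<and> card Z = i})" by auto
  also have "card \<dots> = (\<Sum>i\<le>p. card {Z. Z \<subseteq> T \<and> card Z = i})"
    using assms by (intro card_UN_disjoint) auto
  finally show ?thesis using assms by (simp add: n_subsets)
qed

text \<open>Splitting \<open>Y\<close> into \<open>Y \<inter> T\<close> and \<open>Y - T\<close>
  leaves the second part unconstrained, which produces the power of two.\<close>

lemma card_subsets_card_inter_le:
  assumes "finite V" "T \<subseteq> V"
  shows "card {Y \<in> Pow V. card (Y \<inter> T) \<le> p} = (\<Sum>i\<le>p. card T choose i) * 2 ^ (card V - card T)"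
proof -
  have "bij_betw (\<lambda>Y. (Y \<inter> T, Y - T)) {Y \<in> Pow V. card (Y \<inter> T) \<le> p}
          ({Z. Z \<subseteq> T \<and> card Z \<le> p} \<times> Pow (V - T))"
  proof (rule bij_betwI[where g = "\<lambda>(P, Q). P \<union> Q"])
    show "(\<lambda>(P, Q). P \<union> Q) \<in> {Z. Z \<subseteq> T \<and> card Z \<le> p} \<times> Pow (V - T)
            \<rightarrow> {Y \<in> Pow V. card (Y \<inter> T) \<le> p}"
    proof clarsimp
      fix P Q assume "P \<subseteq> T" "card P \<le> p" "Q \<subseteq> V - T"
      moreover from this have "(P \<union> Q) \<inter> T = P" by auto
      ultimately show "P \<subseteq> V \<and> Q \<subseteq> V \<and> card ((P \<union> Q) \<inter> T) \<le> p" using assms(2) by auto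
    qed
  qed (use assms(2) in auto)
  then show ?thesis
    using assms by (simp add: bij_betw_same_card card_cartesian_product card_subsets_card_le
        finite_subset card_Pow card_Diff_subset)
qed

text \<open>Sending \<open>x\<close> to the set of coordinates where it differs from
  \<open>a\<close> identifies the cube with \<open>Pow {1..n}\<close>, so the centre does not affect
  the count.\<close>

lemma card_cube_ball:
  assumes a: "a \<in> cube n" and T: "T \<subseteq> {1..n}"
  shows "card {x \<in> cube n. card {c \<in> T. x c \<noteq> a c} \<le> p} = (\<Sum>i\<le>p. card T choose i) * 2 ^ (n - card T)"
proof -
  let ?f = "\<lambda>x. {c \<in> {1..n}. x c \<noteq> a c}"
  let ?g = "\<lambda>Y. \<lambda>c\<in>{1..n}. if c \<in> Y then 1 - a c else a c"
  have ac: "a c = 0 \<or> a c = 1" if "c \<in> {1..n}" for c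
    using a that by (auto simp: cube_def PiE_iff)
  have inter: "?f x \<inter> T = {c \<in> T. x c \<noteq> a c}" for x :: "nat \<Rightarrow> nat" using T by auto
  have fg: "?f (?g Y) = Y" if "Y \<subseteq> {1..n}" for Y
    using that ac by (force split: if_splits)
  have gcube: "?g Y \<in> cube n" for Y using ac by (fastforce simp: cube_def)
  have gf: "?g (?f x) = x" if "x \<in> cube n" for x
  proof
    fix c show "?g (?f x) c = x c"
    proof (cases "c \<in> {1..n}")
      case True
      then have "x c = 0 \<or> x c = 1" using that by (auto simp: cube_def PiE_iff)
      with True ac[of c] show ?thesis by auto
    next
      case False
      then have "x c = undefined" using that unfolding cube_def by (metis PiE_arb)
      then show ?thesis using False by (simp only: restrict_apply if_False)
    qed
  qed
  have "bij_betw ?f {x \<in> cube n. card {c \<in> T. x c \<noteq> a c} \<le> p} {Y \<in> Pow {1..n}. card (Y \<inter> T) \<le> p}"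
  proof (rule bij_betwI[where g = ?g])
    show "?g \<in> {Y \<in> Pow {1..n}. card (Y \<inter> T) \<le> p} \<rightarrow> {x \<in> cube n. card {c \<in> T. x c \<noteq> a c} \<le> p}"
    proof
      fix Y assume Y: "Y \<in> {Y \<in> Pow {1..n}. card (Y \<inter> T) \<le> p}"
      then have "{c \<in> T. ?g Y c \<noteq> a c} = Y \<inter> T" using fg[of Y] inter[of "?g Y"] by auto
      then show "?g Y \<in> {x \<in> cube n. card {c \<in> T. x c \<noteq> a c} \<le> p}" using Y gcube by simp
    qed
    show "?f \<in> {x \<in> cube n. card {c \<in> T. x c \<noteq> a c} \<le> p} \<rightarrow> {Y \<in> Pow {1..n}. card (Y \<inter> T) \<le> p}"
      using inter by auto
  qed (use fg gf in blast)+
  from bij_betw_same_card[OF this] show ?thesis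
    using card_subsets_card_inter_le[OF _ T] by simp
qed

lemma sum_choose_Suc:
  "(\<Sum>i\<le>Suc p. Suc N choose i) = (\<Sum>i\<le>Suc p. N choose i) + (\<Sum>i\<le>p. N choose i)"
  by (simp only: sum.atMost_Suc_shift sum.distrib binomial_Suc_Suc binomial_n_0)

text \<open>Write \<open>V(N, p)\<close> for the sum of \<open>N choose i\<close> over
  \<open>i \<le> p\<close>. Pascal's rule applied twice gives
  \<open>V(N + 2, p + 1) = V(N, p + 1) + 2 V(N, p) + V(N, p - 1)\<close>, which is
  \<open>4 V(N, p)\<close> plus \<open>(N choose (p + 1)) - (N choose p)\<close>. Below the middle
  of the row that difference is nonnegative.\<close>

lemma sum_choose_add_2:
  assumes "2 * p + 1 \<le> N"
  shows "4 * (\<Sum>i\<le>p. N choose i) \<le> (\<Sum>i\<le>Suc p. (N + 2) choose i)"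
proof (cases p)
  case 0
  then show ?thesis using assms by simp
next
  case (Suc q)
  have "N choose p \<le> N choose Suc p"
  \<comment> \<open>For \<open>N = 2 * p + 1\<close> the two coefficients are the equal middle ones;
    there \<open>2 * Suc p \<le> N\<close>, needed for monotonicity, just fails.\<close>
  proof (cases "N = 2 * p + 1")
    case True
    then show ?thesis using binomial_symmetric[of p N] by simp
  next
    case False
    then show ?thesis using assms by (intro binomial_mono) auto
  qed
  then show ?thesis
    using sum_choose_Suc[of "Suc N" p] sum_choose_Suc[of N p] sum_choose_Suc[of N q]
    by (simp add: Suc)
qed

text \<open>Raising the dimension by \<open>2 * e\<close> and the radius by \<open>e\<close> never
  lowers the fraction of the cube that a ball fills. Pairs at more than the minimal distance thus
  get sets that are no smaller.\<close>

lemma sum_choose_add_even: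
  assumes "2 * p + 1 \<le> N"
  shows "4 ^ e * (\<Sum>i\<le>p. N choose i) \<le> (\<Sum>i\<le>p + e. (N + 2 * e) choose i)"
proof (induction e)
  case (Suc e)
  have "4 ^ Suc e * (\<Sum>i\<le>p. N choose i) \<le> 4 * (\<Sum>i\<le>p + e. (N + 2 * e) choose i)"
    using Suc by simp
  also have "\<dots> \<le> (\<Sum>i\<le>Suc (p + e). (N + 2 * e + 2) choose i)"
    using assms by (intro sum_choose_add_2) simp
  finally show ?case by (simp add: add.assoc)
qed simp

section \<open>The packing bound\<close>

text \<open>The inequality holds coordinate by coordinate. If only one pair differs, the triangle
  inequality gives a crosswise difference; if both differ and \<open>a c = a' c\<close>, both
  crosswise differences occur; the last term covers the rest.\<close>

lemma card_differ_pairs_le: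
  fixes a b a' b' :: "nat \<Rightarrow> nat"
  shows "hamming_dist n a b + hamming_dist n a' b' \<le> hamming_dist n a b' + hamming_dist n a' b
    + 2 * card {c \<in> {1..n}. a c \<noteq> b c \<and> a' c \<noteq> b' c \<and> a c \<noteq> a' c}"
proof -
  have card_eq: "card {c \<in> {1..n}. P c} = (\<Sum>c\<in>{1..n}. of_bool (P c))" for P
    by (simp add: of_bool_def sum.If_cases Int_def)
  show ?thesis
    unfolding hamming_dist_def card_eq sum_distrib_left sum.distrib[symmetric]
  proof (rule sum_mono)
    fix c
    show "of_bool (a c \<noteq> b c) + of_bool (a' c \<noteq> b' c) \<le> of_bool (a c \<noteq> b' c) + of_bool (a' c \<noteq> b c)
        + 2 * (of_bool (a c \<noteq> b c \<and> a' c \<noteq> b' c \<and> a c \<noteq> a' c) :: nat)"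
      by (cases "a c = b c"; cases "a' c = b' c"; cases "a c = a' c"; simp)
  qed
qed

lemma top_subset_exists:
  fixes S :: "'a::linorder set"
  assumes "finite S" "e \<le> card S"
  shows "\<exists>R\<subseteq>S. card R = e \<and> (\<forall>x\<in>R. \<forall>y\<in>S - R. y < x)"
  using assms
proof (induction e)
  case 0
  show ?case by (intro exI[of _ "{}"]) auto
next
  case (Suc e)
  then obtain R where R: "R \<subseteq> S" "card R = e" "\<forall>x\<in>R. \<forall>y\<in>S - R. y < x" by auto
  have fin: "finite (S - R)" "finite R" using Suc.prems R finite_subset by auto
  have ne: "S - R \<noteq> {}" using Suc.prems R by auto
  define z where "z = Max (S - R)"
  have z: "z \<in> S - R" unfolding z_def by (rule Max_in[OF fin(1) ne])
  have zmax: "y \<le> z" if "y \<in> S - R" for y unfolding z_def using fin(1) that by (rule Max_ge)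
  have "\<forall>x\<in>insert z R. \<forall>y\<in>S - insert z R. y < x"
  proof (intro ballI)
    fix x y assume x: "x \<in> insert z R" and y: "y \<in> S - insert z R"
    show "y < x"
    proof (cases "x = z")
      case True
      have "y \<le> z" using y by (intro zmax) auto
      then show ?thesis using y True by auto
    qed (use x y R(3) in auto)
  qed
  then show ?case using z R fin by (intro exI[of _ "insert z R"]) auto
qed

text \<open>An element of \<open>R\<close> surviving in \<open>S' - R'\<close> and one of
  \<open>R'\<close> surviving in \<open>S - R\<close> would each have to exceed the other. So one
  deleted set absorbs all common losses, giving a maximum where arbitrary deletions would give a
  sum.\<close>

lemma card_top_subsets_inter_le:
  fixes S S' :: "'a::linorder set"
  assumes "finite S" "R \<subseteq> S" "\<forall>x\<in>R. \<forall>y\<in>S - R. y < x"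
    and "finite S'" "R' \<subseteq> S'" "\<forall>x\<in>R'. \<forall>y\<in>S' - R'. y < x"
  shows "card ((R \<union> R') \<inter> (S \<inter> S')) \<le> max (card R) (card R')"
proof -
  have "R \<inter> S' \<subseteq> R' \<or> R' \<inter> S \<subseteq> R"
  proof (rule ccontr)
    assume "\<not> ?thesis"
    then obtain x y where "x \<in> R" "x \<in> S' - R'" "y \<in> R'" "y \<in> S - R" by blast
    then have "y < x" "x < y" using assms by auto
    then show False by simp
  qed
  then have "(R \<union> R') \<inter> (S \<inter> S') \<subseteq> R' \<or> (R \<union> R') \<inter> (S \<inter> S') \<subseteq> R" by auto
  moreover have "finite R" "finite R'" using assms by (auto intro: finite_subset)
  ultimately have "card ((R \<union> R') \<inter> (S \<inter> S')) \<le> card R' \<or> card ((R \<union> R') \<inter> (S \<inter> S')) \<le> card R"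
    by (auto intro: card_mono)
  then show ?thesis by auto
qed

lemma admissible_packing_bound:
  fixes t p m :: nat
  assumes "admissible (int t) (2 * int p + 2) m"
  shows "m * (\<Sum>i\<le>p. (t + 2 * p + 1) choose i) \<le> 2 ^ (t + 2 * p + 1)"
proof -
  define N where "N = t + 2 * p + 1"
  obtain n a b where cube: "\<And>i. i \<in> {1..m} \<Longrightarrow> a i \<in> cube n"
    and far: "\<And>i. i \<in> {1..m} \<Longrightarrow> int (hamming_dist n (a i) (b i)) \<ge> int t + (2 * int p + 2)"
    and near: "\<And>i j. i \<in> {1..m} \<Longrightarrow> j \<in> {1..m} \<Longrightarrow> i \<noteq> j \<Longrightarrow>
      int (hamming_dist n (a i) (b j)) + int (hamming_dist n (a j) (b i)) \<le> 2 * int t"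
    using assms unfolding admissible_def by blast
  define S where "S i = {c \<in> {1..n}. a i c \<noteq> b i c}" for i
  \<comment> \<open>The excess over the guaranteed distance \<open>t + r = N + 1\<close>; by
    \<open>far\<close> the subtraction does not truncate.\<close>
  define x where "x i = card (S i) - (N + 1)" for i
  have cardS: "card (S i) = N + 1 + x i" if "i \<in> {1..m}" for i
    using far[OF that] unfolding x_def S_def hamming_dist_def N_def by linarith
  have finS: "finite (S i)" for i unfolding S_def by simp
  \<comment> \<open>Deleting \<open>1 + x i mod 2\<close> coordinates leaves \<open>N\<close> plus
    an even number, as \<open>sum_choose_add_even\<close> requires.\<close>
  have "\<exists>R. R \<subseteq> S i \<and> card R = 1 + x i mod 2 \<and> (\<forall>x\<in>R. \<forall>y\<in>S i - R. y < x)" if "i \<in> {1..m}" for i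
  proof -
    have "1 + x i mod 2 \<le> card (S i)"
      using cardS[OF that] mod_less_eq_dividend[of "x i" 2] by linarith
    from top_subset_exists[OF finS this] show ?thesis by blast
  qed
  then obtain R where R: "\<And>i. i \<in> {1..m} \<Longrightarrow> R i \<subseteq> S i"
      "\<And>i. i \<in> {1..m} \<Longrightarrow> card (R i) = 1 + x i mod 2"
      "\<And>i. i \<in> {1..m} \<Longrightarrow> \<forall>x\<in>R i. \<forall>y\<in>S i - R i. y < x" by metis
  define T where "T i = S i - R i" for i
  define e where "e i = x i div 2" for i
  define U where "U i = {v \<in> cube n. card {c \<in> T i. v c \<noteq> a i c} \<le> p + e i}" for i
  have finT: "finite (T i)" for i unfolding T_def using finS by simp
  have cardT: "card (T i) = N + 2 * e i" if "i \<in> {1..m}" for i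
  proof -
    have "card (T i) = card (S i) - card (R i)"
      unfolding T_def using R(1)[OF that] finS by (meson card_Diff_subset finite_subset)
    then show ?thesis using cardS[OF that] R(2)[OF that] unfolding e_def by presburger
  qed
  have disj: "U i \<inter> U j = {}" if ij: "i \<in> {1..m}" "j \<in> {1..m}" "i \<noteq> j" for i j
  proof (rule ccontr)
    assume "U i \<inter> U j \<noteq> {}"
    then obtain v where v: "card {c \<in> T i. v c \<noteq> a i c} \<le> p + e i" "card {c \<in> T j. v c \<noteq> a j c} \<le> p + e j"
      unfolding U_def by auto
    define X where "X = {c \<in> {1..n}. a i c \<noteq> b i c \<and> a j c \<noteq> b j c \<and> a i c \<noteq> a j c}"
    let ?L = "(R i \<union> R j) \<inter> (S i \<inter> S j)"
    let ?Mi = "{c \<in> T i. v c \<noteq> a i c}" and ?Mj = "{c \<in> T j. v c \<noteq> a j c}"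
    have fin: "finite (?Mi \<union> ?Mj \<union> ?L)" using finT finS by simp
    \<comment> \<open>A coordinate of \<open>X\<close> lies in both \<open>S i\<close> and
      \<open>S j\<close>. If neither puncturing removes it, \<open>v\<close> cannot agree there with
      both \<open>a i\<close> and \<open>a j\<close>, which differ.\<close>
    have "X \<subseteq> ?Mi \<union> ?Mj \<union> ?L" unfolding X_def T_def S_def by auto
    then have "card X \<le> card (?Mi \<union> ?Mj \<union> ?L)" using fin by (rule card_mono[rotated])
    also have "\<dots> \<le> card ?Mi + card ?Mj + card ?L"
      using card_Un_le[of "?Mi \<union> ?Mj" ?L] card_Un_le[of ?Mi ?Mj] by linarith
    finally have "card X \<le> 2 * p + e i + e j + max (1 + x i mod 2) (1 + x j mod 2)"
      using v card_top_subsets_inter_le[OF finS R(1,3)[OF ij(1)] finS R(1,3)[OF ij(2)]]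
        R(2)[OF ij(1)] R(2)[OF ij(2)] by linarith
    moreover have "(N + 1 + x i) + (N + 1 + x j) \<le> 2 * t + 2 * card X"
      using card_differ_pairs_le[of n "a i" "b i" "a j" "b j"] near[OF ij] cardS[OF ij(1)] cardS[OF ij(2)]
      unfolding X_def hamming_dist_def S_def by linarith
    moreover have "x i = 2 * e i + x i mod 2" "x j = 2 * e j + x j mod 2" unfolding e_def by simp_all
    moreover have "x i mod 2 = 0 \<or> x i mod 2 = 1" "x j mod 2 = 0 \<or> x j mod 2 = 1" by auto
    \<comment> \<open>With \<open>u\<close> and \<open>w\<close> the parities of \<open>x i\<close>
      and \<open>x j\<close>, the two bounds on \<open>card X\<close> combine to
      \<open>2 + u + w \<le> 2 * max u w\<close>, impossible for values in
      \<open>{0, 1}\<close>.\<close>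
    ultimately show False unfolding N_def by (elim disjE) simp_all
  qed
  have vol: "2 ^ n * (\<Sum>i\<le>p. N choose i) \<le> 2 ^ N * card (U i)" if i: "i \<in> {1..m}" for i
  proof -
    have sub: "T i \<subseteq> {1..n}" unfolding T_def S_def by auto
    have "card (T i) \<le> n" using card_mono[OF _ sub] by simp
    then have le: "N + 2 * e i \<le> n" using cardT[OF i] by simp
    have "2 ^ n * (\<Sum>i\<le>p. N choose i) = 2 ^ N * (2 ^ (n - (N + 2 * e i)) * (4 ^ e i * (\<Sum>i\<le>p. N choose i)))"
    proof -
      have "(2::nat) ^ n = 2 ^ (N + (n - (N + 2 * e i)) + 2 * e i)" using le by simp
      then show ?thesis by (simp only: power_add power_mult) simp
    qed
    also have "\<dots> \<le> 2 ^ N * (2 ^ (n - (N + 2 * e i)) * (\<Sum>j\<le>p + e i. (N + 2 * e i) choose j))"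
      by (intro mult_le_mono order_refl sum_choose_add_even) (simp add: N_def)
    also have "\<dots> = 2 ^ N * card (U i)"
      unfolding U_def card_cube_ball[OF cube[OF i] sub] cardT[OF i] by (simp add: mult.commute)
    finally show ?thesis .
  qed
  have fincube: "finite (cube n)" and cardcube: "card (cube n) = 2 ^ n"
    unfolding cube_def by (auto intro: finite_PiE simp: card_PiE numeral_2_eq_2)
  have "2 ^ n * (m * (\<Sum>i\<le>p. N choose i)) = (\<Sum>i\<in>{1..m}. 2 ^ n * (\<Sum>i\<le>p. N choose i))" by simp
  also have "\<dots> \<le> (\<Sum>i\<in>{1..m}. 2 ^ N * card (U i))" using vol by (rule sum_mono)
  also have "\<dots> = 2 ^ N * card (\<Union>i\<in>{1..m}. U i)"
    using disj fincube by (subst card_UN_disjoint) (auto simp: sum_distrib_left U_def)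
  also have "\<dots> \<le> 2 ^ N * 2 ^ n"
    unfolding cardcube[symmetric] using fincube by (intro mult_le_mono2 card_mono) (auto simp: U_def)
  finally show ?thesis unfolding N_def by simp
qed

text \<open>Two distinct indices would make a sum of two distances negative. This covers
  \<open>s < 2 * (k + 1)\<close>, where packing does not apply.\<close>

lemma admissible_negative:
  assumes "admissible t r m" "t < 0"
  shows "m \<le> 1"
proof (rule ccontr)
  assume "\<not> m \<le> 1"
  then have "(1::nat) \<in> {1..m}" "(2::nat) \<in> {1..m}" "(1::nat) \<noteq> 2" by auto
  with assms(1) obtain n a b where
    "int (hamming_dist n (a (1::nat)) (b (2::nat))) + int (hamming_dist n (a 2) (b 1)) \<le> 2 * t"
    unfolding admissible_def by blast
  then show False using assms(2) by linarith
qed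

section \<open>From set pairs to vectors\<close>

lemma card_differ_indicators:
  assumes "P \<subseteq> {1..n}" "Q \<subseteq> {1..n}"
  shows "int (hamming_dist n (\<lambda>c\<in>{1..n}. of_bool (c \<in> P)) (\<lambda>c\<in>{1..n}. of_bool (c \<in> Q)))
    = int (card P) + int (card Q) - 2 * int (card (P \<inter> Q))"
proof -
  have fin: "finite P" "finite Q" using assms finite_subset by auto
  have "hamming_dist n (\<lambda>c\<in>{1..n}. of_bool (c \<in> P)) (\<lambda>c\<in>{1..n}. of_bool (c \<in> Q)) = card ((P - Q) \<union> (Q - P))"
    unfolding hamming_dist_def using assms by (intro arg_cong[where f = card]) auto
  also have "\<dots> = card (P - Q) + card (Q - P)" using fin by (intro card_Un_disjoint) auto
  finally show ?thesis
    using card_Diff_subset_Int[of P Q] card_Diff_subset_Int[of Q P] fin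
      card_mono[of P "P \<inter> Q"] card_mono[of Q "P \<inter> Q"] by (simp add: Int_commute)
qed

lemma admissible_set_pairs:
  fixes A B :: "nat \<Rightarrow> 'a set"
  assumes fin: "\<And>i. i \<in> {1..m} \<Longrightarrow> finite (A i) \<and> finite (B i)"
    and size: "\<And>i. i \<in> {1..m} \<Longrightarrow> card (A i) + card (B i) = s"
    and diag: "\<And>i. i \<in> {1..m} \<Longrightarrow> card (A i \<inter> B i) \<le> l"
    and cross: "\<And>i j. 1 \<le> i \<Longrightarrow> i < j \<Longrightarrow> j \<le> m \<Longrightarrow>
      card (A i \<inter> B j) + card (A j \<inter> B i) \<ge> 2 * (k + 1)"
  shows "admissible (int s - 2 * (int k + 1)) (2 * (int k + 1) - 2 * int l) m"
proof -
  define W where "W = (\<Union>i\<in>{1..m}. A i \<union> B i)"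
  \<comment> \<open>The \<open>s\<close> extra coordinates ensure \<open>n > t\<close>; all
    indicator vectors are 0 there, so distances are unaffected.\<close>
  define n where "n = card W + s"
  have "finite W" unfolding W_def using fin by auto
  then obtain h where h: "bij_betw h W {1..card W}"
    using ex_bij_betw_finite_nat[of W] bij_betw_iff_card[of W "{1..card W}"] by auto
  then have inj: "inj_on h W" and img: "h ` W = {1..card W}" by (auto simp: bij_betw_def)
  define ind where "ind P = (\<lambda>c\<in>{1..n}. of_bool (c \<in> h ` P) :: nat)" for P
  have ind_cube: "ind P \<in> cube n" for P
    unfolding ind_def cube_def by (auto simp: PiE_iff of_bool_def)
  have dist: "int (hamming_dist n (ind P) (ind Q)) = int (card P) + int (card Q) - 2 * int (card (P \<inter> Q))"
    if "P \<subseteq> W" "Q \<subseteq> W" for P Q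
  proof -
    have "{1..card W} \<subseteq> {1..n}" unfolding n_def by simp
    then have "h ` P \<subseteq> {1..n}" "h ` Q \<subseteq> {1..n}" using that img by (metis image_mono order_trans)+
    moreover have "h ` P \<inter> h ` Q = h ` (P \<inter> Q)" using inj_on_image_Int[OF inj that] ..
    ultimately show ?thesis
      unfolding ind_def using inj that
      by (subst card_differ_indicators) (simp_all add: card_image inj_on_subset le_infI1)
  qed
  have W: "A i \<subseteq> W" "B i \<subseteq> W" if "i \<in> {1..m}" for i using that unfolding W_def by auto
  have cross': "card (A i \<inter> B j) + card (A j \<inter> B i) \<ge> 2 * (k + 1)"
    if "i \<in> {1..m}" "j \<in> {1..m}" "i \<noteq> j" for i j
    using cross[of i j] cross[of j i] that by (cases "i < j") auto
  show ?thesis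
    unfolding admissible_def
  proof (intro exI conjI ballI impI)
    show "int s - 2 * (int k + 1) < int n" unfolding n_def by simp
    show "ind (A i) \<in> cube n" "ind (B i) \<in> cube n" for i by (rule ind_cube)+
    fix i assume i: "i \<in> {1..m}"
    show "int (hamming_dist n (ind (A i)) (ind (B i))) \<ge> int s - 2 * (int k + 1) + (2 * (int k + 1) - 2 * int l)"
      using dist[OF W[OF i]] size[OF i] diag[OF i] by linarith
    fix j assume j: "j \<in> {1..m}" and ij: "i \<noteq> j"
    have "int (2 * (k + 1)) \<le> int (card (A i \<inter> B j) + card (A j \<inter> B i))"
      using cross'[OF i j ij] by (simp only: of_nat_le_iff)
    then have "2 * (int k + 1) \<le> int (card (A i \<inter> B j)) + int (card (A j \<inter> B i))" by simp
    moreover have "int (card (A i)) + int (card (B i)) = int s" "int (card (A j)) + int (card (B j)) = int s"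
      using size[OF i] size[OF j] by linarith+
    ultimately show "int (hamming_dist n (ind (A i)) (ind (B j))) + int (hamming_dist n (ind (A j)) (ind (B i)))
        \<le> 2 * (int s - 2 * (int k + 1))"
      using dist[OF W(1)[OF i] W(2)[OF j]] dist[OF W(1)[OF j] W(2)[OF i]] by (simp add: algebra_simps)
  qed
qed

theorem theorem3p4:
  fixes s k l m :: nat
    and A B :: "nat \<Rightarrow> 'a set"
  assumes "s > k" and "k \<ge> l"
    and "\<And>i. i \<in> {1..m} \<Longrightarrow> finite (A i) \<and> finite (B i)"
    and "\<And>i. i \<in> {1..m} \<Longrightarrow> card (A i) + card (B i) = s"
    and "\<And>i. i \<in> {1..m} \<Longrightarrow> card (A i \<inter> B i) \<le> l"
    and "\<And>i j. 1 \<le> i \<Longrightarrow> i < j \<Longrightarrow> j \<le> m \<Longrightarrow>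
           card (A i \<inter> B j) + card (A j \<inter> B i) \<ge> 2 * (k + 1)"
  shows "m \<le> f_prime (int s - 2 * (int k + 1)) (2 * (int k + 1) - 2 * int l) \<and>
    (s \<ge> 2 * l + 1 \<longrightarrow>
       real (f_prime (int s - 2 * (int k + 1)) (2 * (int k + 1) - 2 * int l))
         \<le> 2 ^ (s - 2 * l - 1) / (\<Sum>i=0..k - l. real ((s - 2 * l - 1) choose i)))"
proof -
  let ?adm = "admissible (int s - 2 * (int k + 1)) (2 * (int k + 1) - 2 * int l)"
  \<comment> \<open>Truncated to 0 when \<open>s \<le> 2 * l\<close>; then \<open>?V = 1\<close> and
    \<open>bound\<close> reads \<open>m' \<le> 1\<close>, so it stays true without
    \<open>s \<ge> 2 * l + 1\<close>.\<close>
  let ?N = "s - 2 * l - 1"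
  let ?V = "\<Sum>i\<le>k - l. ?N choose i"
  have adm: "?adm m" by (rule admissible_set_pairs[of m A B s l k, OF assms(3-6)])
  have Vpos: "?V \<ge> 1"
    using member_le_sum[of 0 "{..k - l}" "\<lambda>i. ?N choose i"] by simp
  have bound: "m' * ?V \<le> 2 ^ ?N" if "?adm m'" for m'
  proof (cases "2 * (k + 1) \<le> s")
    case True
    define t where "t = s - 2 * (k + 1)"
    have eqs: "int s - 2 * (int k + 1) = int t" "2 * (int k + 1) - 2 * int l = 2 * int (k - l) + 2"
      using True assms(2) unfolding t_def by auto
    have "m' * (\<Sum>i\<le>k - l. (t + 2 * (k - l) + 1) choose i) \<le> 2 ^ (t + 2 * (k - l) + 1)"
      by (rule admissible_packing_bound) (rule that[unfolded eqs])
    moreover have "t + 2 * (k - l) + 1 = ?N" using True assms(2) unfolding t_def by auto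
    ultimately show ?thesis by metis
  next
    case False
    then have "m' \<le> 1" using admissible_negative[OF that] by simp
    moreover have "?V \<le> 2 ^ ?N"
    proof -
      have "?V = card {Z. Z \<subseteq> {..<?N} \<and> card Z \<le> k - l}" by (simp add: card_subsets_card_le)
      also have "\<dots> \<le> card (Pow {..<?N})" by (intro card_mono) auto
      finally show ?thesis by (simp add: card_Pow)
    qed
    ultimately show ?thesis by (metis le_trans mult_le_mono1 nat_mult_1)
  qed
  \<comment> \<open>A bound on all admissible values, together with \<open>adm\<close>, ensures that
    the \<open>GREATEST\<close> in \<open>f_prime\<close> is attained.\<close>
  have ub: "m' \<le> 2 ^ ?N" if "?adm m'" for m'
    using bound[OF that] Vpos by (metis le_trans mult_le_mono2 nat_mult_1_right)
  have "m \<le> f_prime (int s - 2 * (int k + 1)) (2 * (int k + 1) - 2 * int l)"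
    unfolding f_prime_def using adm ub by (rule Greatest_le_nat[where P = ?adm])
  moreover have "?adm (f_prime (int s - 2 * (int k + 1)) (2 * (int k + 1) - 2 * int l))"
    unfolding f_prime_def using adm ub by (rule GreatestI_nat[where P = ?adm])
  then have le: "real (f_prime (int s - 2 * (int k + 1)) (2 * (int k + 1) - 2 * int l) * ?V) \<le> real (2 ^ ?N)"
    by (intro of_nat_mono bound)
  have "real ?V > 0" using Vpos by linarith
  with le have "real (f_prime (int s - 2 * (int k + 1)) (2 * (int k + 1) - 2 * int l))
      \<le> 2 ^ ?N / real ?V"
    by (simp only: pos_le_divide_eq of_nat_mult of_nat_power of_nat_numeral)
  ultimately show ?thesis by (simp add: atLeast0AtMost)
qed

end
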